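(* Let $i=\sqrt{-1}$ and let $(b_n)_{n\geq 0}$ be the sequence of complex numbers defined recursively by $b_0=0$ and, for $n\geq 1$, \[b_n=(n+b_{n-1})(1+i).\] Let $a_n=\operatorname{Re}(b_n)$ for $n\geq 0$. Then, for every $n\geq 0$, \[a_n=2^{\frac n2+1}\sin\left(\frac{n\pi}{4}\right)-n.\] *)

theory Defs
  imports Complex_Main
begin

end

(* The recursion is affine: it has the particular solution (i - 1) n + 2 i, and the homogeneous
   part contributes a multiple of (1 + i)^n, whose imaginary part is read off from its polar form. *)
theory Submission
  imports Defs
begin

text \<open>Solving the recursion leaves \<open>(1 + \<i>) ^ n\<close> as the only non-linear term
  of \<open>b n\<close>. De Moivre turns its modulus and argument into the power of 2 and the
  sine.\<close>

lemma one_plus_ii_polar: "1 + \<i> = complex_of_real (sqrt 2) * cis (pi / 4)"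
  by (simp add: complex_eq_iff cos_45 sin_45)

lemma Im_one_plus_ii_power:
  "Im ((1 + \<i>) ^ n) = 2 powr (real n / 2) * sin (real n * pi / 4)"
proof -
  have "sqrt 2 ^ n = 2 powr (real n / 2)"
    by (simp add: powr_half_sqrt [symmetric] powr_powr flip: powr_realpow)
  then show ?thesis
    by (simp add: one_plus_ii_polar power_mult_distrib DeMoivre flip: of_real_power)
qed

text \<open>The coefficient \<open>- 2 * \<i>\<close> of the homogeneous part is forced by
  \<open>b 0 = 0\<close>.\<close>

lemma affine_recurrence_closed_form:
  fixes b :: "nat \<Rightarrow> complex"
  assumes "b 0 = 0"
    and "\<And>n::nat. n \<ge> 1 \<Longrightarrow> b n = (of_nat n + b (n - 1)) * (1 + \<i>)"
  shows "b n = (\<i> - 1) * of_nat n + 2 * \<i> - 2 * \<i> * (1 + \<i>) ^ n"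
proof (induction n)
  case 0
  then show ?case using assms(1) by simp
next
  case (Suc n)
  have "b (Suc n) = (of_nat (Suc n) + b n) * (1 + \<i>)"
    using assms(2)[of "Suc n"] by simp
  then show ?case
    unfolding Suc.IH by (simp add: algebra_simps)
qed

theorem theorem7:
  fixes b :: "nat \<Rightarrow> complex" and a :: "nat \<Rightarrow> real"
  assumes b0: "b 0 = 0"
    and b_rec: "\<And>n::nat. n \<ge> 1 \<Longrightarrow> b n = (of_nat n + b (n - 1)) * (1 + \<i>)"
    and a_def: "\<And>n::nat. a n = Re (b n)"
  shows "\<forall>n::nat. a n = 2 powr (real n / 2 + 1) * sin (real n * pi / 4) - real n"
proof
  fix n
  \<comment> \<open>Here \<open>Re (- 2 * \<i> * z) = 2 * Im z\<close>, the term
    \<open>2 * \<i>\<close> has real part 0, and \<open>\<i> - 1\<close> contributes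
    \<open>- real n\<close>.\<close>
  have "a n = 2 * Im ((1 + \<i>) ^ n) - real n"
    using affine_recurrence_closed_form [OF b0 b_rec, of n] by (simp add: a_def)
  then show "a n = 2 powr (real n / 2 + 1) * sin (real n * pi / 4) - real n"
    by (simp add: Im_one_plus_ii_power powr_add)
qed

end
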